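(* Let $(m,n,k)\in\mathbb{Z}^3$ be such that $k^2-4mn>0$ is not a perfect square. The period $\Gamma(m,n,k)$ is bipalindromic if and only if the class $C(m,n,k)$ is $k$-symmetric.
   Context: The triple $\mathbf f=(m,n,k)\in\mathbb{Z}^3$ denotes the binary quadratic form $f(x,y)=mx^2+ny^2+kxy$. The class $C(\mathbf f)=C(m,n,k)$ is the orbit of $\mathbf f$ under the action of $\mathrm{SL}(2,\mathbb{Z})$ by linear changes of the variables $(x,y)$. For $\mathbf f=(m,n,k)$ define the conjugate $\overline{\mathbf f}=(m,n,-k)$, the adjoint $\mathbf f^*=(-n,-m,k)$ and the antipodal $\overline{\mathbf f}^*=(-n,-m,-k)$. If a class contains one form together with its image under one of these involutions, the whole class is invariant under that involution. A class is called $k$-symmetric if it is invariant under the conjugation but not under the adjoint nor the antipodal involution. For $k^2-4mn>0$ not a perfect square, put $\xi^{+}(\mathbf f)=\frac{-k+\sqrt{k^2-4mn}}{2m}$; its (regular) continued fraction is eventually periodic (the continued fraction of a negative number $\xi$ is written $-[\alpha_0,\alpha_1,\dots]$, where $[\alpha_0,\alpha_1,\dots]$ is that of $|\xi|$). $\Gamma(m,n,k)$ denotes its period, i.e. its minimal repeating block of positive integers, considered up to cyclic permutation. A period is bipalindromic if some cyclic permutation of it can be subdivided into two consecutive (nonempty) sequences, each of odd length and each a palindrome (equal to itself read backwards). *)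

theory Defs
  imports Complex_Main "HOL-Computational_Algebra.Nth_Powers"
begin

text \<open>The triple \<open>(m, n, k)\<close> stands for the form \<open>m x\<^sup>2 + n y\<^sup>2 + k x y\<close>:
  the coefficient of the mixed term comes last.\<close>

type_synonym qform = "int \<times> int \<times> int"

fun form_eval :: "qform \<Rightarrow> int \<Rightarrow> int \<Rightarrow> int" where
  "form_eval (m, n, k) x y = m * x\<^sup>2 + n * y\<^sup>2 + k * x * y"

definition form_class :: "qform \<Rightarrow> qform set" where
  "form_class f = {g. \<exists>a b c d. a * d - b * c = 1 \<and>
     (\<forall>x y. form_eval g x y = form_eval f (a * x + b * y) (c * x + d * y))}"

fun form_conj :: "qform \<Rightarrow> qform" where
  "form_conj (m, n, k) = (m, n, - k)"

fun form_adjoint :: "qform \<Rightarrow> qform" where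
  "form_adjoint (m, n, k) = (- n, - m, k)"

fun form_antipodal :: "qform \<Rightarrow> qform" where
  "form_antipodal (m, n, k) = (- n, - m, - k)"

definition invariant_under :: "(qform \<Rightarrow> qform) \<Rightarrow> qform set \<Rightarrow> bool" where
  "invariant_under \<sigma> C \<longleftrightarrow> \<sigma> ` C = C"

definition k_symmetric :: "qform set \<Rightarrow> bool" where
  "k_symmetric C \<longleftrightarrow> invariant_under form_conj C \<and>
     \<not> invariant_under form_adjoint C \<and> \<not> invariant_under form_antipodal C"

fun xi_plus :: "qform \<Rightarrow> real" where
  "xi_plus (m, n, k) =
     (- real_of_int k + sqrt (real_of_int (k\<^sup>2 - 4 * m * n))) / (2 * real_of_int m)"

text \<open>Complete quotients and partial quotients of the regular continued fraction. Only irrational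
  arguments matter here, so the expansion never terminates and \<open>frac\<close> never vanishes.\<close>

primrec cf_rem :: "real \<Rightarrow> nat \<Rightarrow> real" where
  "cf_rem x 0 = x"
| "cf_rem x (Suc i) = 1 / frac (cf_rem x i)"

definition cf_coeff :: "real \<Rightarrow> nat \<Rightarrow> int" where
  "cf_coeff x i = \<lfloor>cf_rem x i\<rfloor>"

definition repeating_block :: "(nat \<Rightarrow> int) \<Rightarrow> int list \<Rightarrow> bool" where
  "repeating_block a p \<longleftrightarrow> p \<noteq> [] \<and> (\<exists>N. \<forall>i. a (N + i) = p ! (i mod length p))"

text \<open>A period up to cyclic permutation is represented by the set of all its representatives, that
  is, of all repeating blocks of minimal length (see \<open>min_blocks_rotate\<close>).\<close>

definition min_blocks :: "(nat \<Rightarrow> int) \<Rightarrow> int list set" where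
  "min_blocks a = {p. repeating_block a p \<and> (\<forall>q. repeating_block a q \<longrightarrow> length p \<le> length q)}"

text \<open>The absolute value implements the convention that a negative \<open>\<xi>\<close> is expanded as
  \<open>-[\<alpha>\<^sub>0, \<alpha>\<^sub>1, \<dots>]\<close> with \<open>[\<alpha>\<^sub>0, \<alpha>\<^sub>1, \<dots>]\<close> the continued fraction of \<open>\<bar>\<xi>\<bar>\<close>.\<close>

definition Period :: "qform \<Rightarrow> int list set" where
  "Period f = min_blocks (cf_coeff \<bar>xi_plus f\<bar>)"

definition palindrome :: "'a list \<Rightarrow> bool" where
  "palindrome u \<longleftrightarrow> rev u = u"

text \<open>Ranging over \<open>P\<close> amounts to ranging over all cyclic permutations of the period. The two
  parts are nonempty since their lengths are odd.\<close>

definition bipalindromic :: "'a list set \<Rightarrow> bool" where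
  "bipalindromic P \<longleftrightarrow> (\<exists>u v. u @ v \<in> P \<and> odd (length u) \<and> odd (length v) \<and>
     palindrome u \<and> palindrome v)"

lemma repeating_block_rotate:
  assumes "repeating_block a p"
  shows "repeating_block a (rotate r p)"
proof -
  obtain N where p: "p \<noteq> []" and N: "\<And>i. a (N + i) = p ! (i mod length p)"
    using assms by (auto simp: repeating_block_def)
  have "a (N + r + i) = rotate r p ! (i mod length (rotate r p))" for i
    using N[of "r + i"] p by (simp add: nth_rotate add.assoc mod_add_right_eq)
  then show ?thesis
    unfolding repeating_block_def using p by (auto intro!: exI[of _ "N + r"])
qed

lemma min_blocks_rotate:
  assumes "p \<in> min_blocks a"
  shows "min_blocks a = {rotate r p |r. True}"
proof (intro set_eqI iffI)
  fix q assume "q \<in> {rotate r p |r. True}"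
  then show "q \<in> min_blocks a"
    using assms by (auto simp: min_blocks_def repeating_block_rotate)
next
  fix q assume q: "q \<in> min_blocks a"
  have len: "length q = length p"
    using assms q by (auto simp: min_blocks_def intro: antisym)
  obtain N where p: "p \<noteq> []" and N: "\<And>i. a (N + i) = p ! (i mod length p)"
    using assms by (auto simp: min_blocks_def repeating_block_def)
  obtain M where M: "\<And>i. a (M + i) = q ! (i mod length p)"
    using q len by (auto simp: min_blocks_def repeating_block_def)
  define r where "r = M + length p * N - N"
  have "N \<le> length p * N" using p by (cases p) auto
  then have r: "N + r = M + length p * N" unfolding r_def by linarith
  have "q = rotate r p"
  proof (rule nth_equalityI)
    fix i assume i: "i < length q"
    have "q ! i = a (M + (length p * N + i))"
      using M[of "length p * N + i"] i len by simp
    also have "\<dots> = a (N + (r + i))" using r by (simp add: add.assoc[symmetric])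
    also have "\<dots> = rotate r p ! i" using N[of "r + i"] i len by (simp add: nth_rotate)
    finally show "q ! i = rotate r p ! i" .
  qed (simp add: len)
  then show "q \<in> {rotate r p |r. True}" by blast
qed

end

theory Submission imports Defs begin

text \<open>
The proof translates both sides into statements about the roots \<open>x = \<xi>\<^sup>+(f)\<close> and its conjugate \<open>x'\<close>.
Two forms of the same discriminant are in one class iff their \<open>\<xi>\<^sup>+\<close> are related by a Moebius
transformation of determinant \<open>1\<close> (\<open>form_class_iff_mobius_rel\<close>). The conjugate, adjoint and antipodal
forms have the roots \<open>- x'\<close>, \<open>- 1 / x'\<close> and \<open>1 / x\<close>; as \<open>z \<mapsto> - z\<close> and \<open>z \<mapsto> 1 / z\<close> have determinant
\<open>- 1\<close>, the class is \<open>k\<close>-symmetric iff some matrix of determinant \<open>- 1\<close> maps \<open>x\<close> to \<open>x'\<close> but none fixes \<open>x\<close>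
(\<open>k_symmetric_iff_mobius_rel\<close>).

Serret's theorem in a form that keeps track of the determinant says that irrational numbers are
connected by an integer matrix of determinant \<open>\<plusminus> 1\<close> iff their continued fractions have a common tail, and that
the sign is \<open>+\<close> iff the indices where this tail starts have the same parity
(\<open>tail_rel_iff_mobius_rel\<close>). By Lagrange's theorem (\<open>cf_rem_eventually_periodic\<close>) a late complete
quotient \<open>\<theta>\<close> of \<open>\<bar>x\<bar>\<close> is purely periodic, with minimal period \<open>p\<close> say, and then
\<open>- 1 / \<theta>'\<close> is purely periodic with the reversed period (\<open>periodic_tail_with_dual\<close>).

So a matrix of determinant \<open>- 1\<close> fixes \<open>x\<close> iff \<open>p\<close> has odd length (\<open>odd_length_iff_tail_rel\<close>). When the
length is even, a matrix of determinant \<open>- 1\<close> maps \<open>x\<close> to \<open>x'\<close> iff \<open>rev p\<close> is a rotation of \<open>p\<close> by an odd number of places.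
Such a rotation cuts \<open>p\<close> into two parts of odd length, each of which equals its own reversal, and
conversely (\<open>palindromes_if_rev_eq_rotate\<close>, \<open>rev_eq_rotate_if_palindromes\<close>): this is bipalindromicity.
\<close>

section \<open>Complete quotients of an irrational number\<close>

lemma cf_rem_add: "cf_rem x (i + j) = cf_rem (cf_rem x i) j"
  by (induction j) auto

lemma Rats_frac_iff: "frac x \<in> \<rat> \<longleftrightarrow> x \<in> \<rat>"
proof
  assume "frac x \<in> \<rat>"
  then have "frac x + of_int \<lfloor>x\<rfloor> \<in> \<rat>" by (intro Rats_add) auto
  then show "x \<in> \<rat>" by (simp add: frac_def)
qed (auto simp: frac_def)

lemma Rats_inverse_iff: "1 / x \<in> \<rat> \<longleftrightarrow> x \<in> \<rat>" for x :: real
  by (metis Rats_inverse inverse_eq_divide inverse_inverse_eq)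

lemma irrational_cf_rem: "x \<notin> \<rat> \<Longrightarrow> cf_rem x i \<notin> \<rat>"
  by (induction i) (auto simp: Rats_inverse_iff Rats_frac_iff)

lemma frac_irrational: "x \<notin> \<rat> \<Longrightarrow> 0 < frac x \<and> frac x < 1"
  by (metis Rats_of_int Ints_cases frac_gt_0_iff frac_lt_1)

lemma cf_rem_Suc_gt_1: "x \<notin> \<rat> \<Longrightarrow> 1 < cf_rem x (Suc i)"
  using frac_irrational[OF irrational_cf_rem, of x i] by simp

lemma cf_coeff_Suc_ge_1: "x \<notin> \<rat> \<Longrightarrow> 1 \<le> cf_coeff x (Suc i)"
  using cf_rem_Suc_gt_1[of x i] unfolding cf_coeff_def by linarith

lemma cf_coeff_cf_rem: "cf_coeff (cf_rem x i) j = cf_coeff x (i + j)"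
  by (simp add: cf_coeff_def cf_rem_add)

lemma cf_rem_step: "x \<notin> \<rat> \<Longrightarrow> cf_rem x i = of_int (cf_coeff x i) + 1 / cf_rem x (Suc i)"
  by (simp add: cf_coeff_def frac_def)

text \<open>The gap between two complete quotients is divided by \<open>x\<^sub>i\<^sub>+\<^sub>1 y\<^sub>i\<^sub>+\<^sub>1\<close> on the way
  back from index \<open>i + 1\<close> to index \<open>i\<close>. One such factor may be close to \<open>1\<close>, but the product of
  two consecutive ones is at least \<open>4\<close>; since equal integer parts keep every gap
  below \<open>1\<close>, the initial gap is \<open>0\<close>.\<close>

lemma cf_coeff_inject:
  assumes "x \<notin> \<rat>" "y \<notin> \<rat>" "\<And>i. cf_coeff x i = cf_coeff y i"
  shows "x = y"
proof -
  define D where "D i = \<bar>cf_rem x i - cf_rem y i\<bar>" for i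
  have step: "D i = D (Suc i) / (cf_rem x (Suc i) * cf_rem y (Suc i))" for i
  proof -
    have "cf_rem x (Suc i) > 1" "cf_rem y (Suc i) > 1" using assms cf_rem_Suc_gt_1 by blast+
    moreover have "cf_rem x i - cf_rem y i = 1 / cf_rem x (Suc i) - 1 / cf_rem y (Suc i)"
      using cf_rem_step[of x i] cf_rem_step[of y i] assms by simp
    ultimately show ?thesis unfolding D_def
      by (simp add: diff_frac_eq abs_mult abs_minus_commute del: cf_rem.simps)
  qed
  have prod2: "cf_rem z (Suc i) * cf_rem z (Suc (Suc i)) \<ge> 2" if "z \<notin> \<rat>" for z i
  proof -
    have gt: "cf_rem z (Suc (Suc i)) > 1" using that cf_rem_Suc_gt_1 by blast
    have "cf_rem z (Suc i) * cf_rem z (Suc (Suc i)) =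
       of_int (cf_coeff z (Suc i)) * cf_rem z (Suc (Suc i)) + 1"
      using cf_rem_step[OF that, of "Suc i"] gt by (simp add: field_simps del: cf_rem.simps)
    moreover have "of_int (cf_coeff z (Suc i)) * cf_rem z (Suc (Suc i)) \<ge> 1 * 1"
      using gt cf_coeff_Suc_ge_1[OF that, of i] by (intro mult_mono) auto
    ultimately show ?thesis by linarith
  qed
  \<comment> \<open>Two steps expand the gap by \<open>(x\<^sub>i\<^sub>+\<^sub>1 x\<^sub>i\<^sub>+\<^sub>2) (y\<^sub>i\<^sub>+\<^sub>1 y\<^sub>i\<^sub>+\<^sub>2)\<close>, a product of two factors that are at least \<open>2\<close>.\<close>
  have two: "4 * D i \<le> D (i + 2)" for i
  proof -
    have pos: "cf_rem x (Suc i) > 1" "cf_rem y (Suc i) > 1" "cf_rem x (Suc (Suc i)) > 1" "cf_rem y (Suc (Suc i)) > 1"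
      using assms cf_rem_Suc_gt_1 by blast+
    let ?P = "(cf_rem x (Suc i) * cf_rem x (Suc (Suc i))) * (cf_rem y (Suc i) * cf_rem y (Suc (Suc i)))"
    have "2 * 2 \<le> ?P"
      using prod2[OF assms(1), of i] prod2[OF assms(2), of i] by (intro mult_mono) auto
    moreover have "D i * ?P = D (i + 2)"
      using step[of i] step[of "Suc i"] pos by (simp add: field_simps del: cf_rem.simps)
    moreover have "D i \<ge> 0" unfolding D_def by simp
    ultimately show ?thesis using mult_left_mono[of 4 ?P "D i"] by simp
  qed
  have lt1: "D i < 1" for i
    using assms(3)[of i] unfolding D_def cf_coeff_def by linarith
  have pw: "4 ^ j * D 0 \<le> D (2 * j)" for j
  proof (induction j)
    case (Suc j)
    then show ?case using two[of "2 * j"] by simp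
  qed simp
  have "D 0 = 0"
  proof (rule ccontr)
    assume "D 0 \<noteq> 0"
    then have p: "D 0 > 0" unfolding D_def by simp
    obtain j where "1 / D 0 < 4 ^ j" using real_arch_pow[of 4 "1 / D 0"] by auto
    then have "1 < 4 ^ j * D 0" using p by (simp add: field_simps)
    then show False using pw[of j] lt1[of "2 * j"] by linarith
  qed
  then show ?thesis unfolding D_def by simp
qed

section \<open>Tail equivalence with index parity\<close>

text \<open>The flag is \<open>True\<close> when the two matching tails start at indices of the same parity. Flags compose
  by equality of truth values, which is multiplication in a group of order two.\<close>

definition tail_rel :: "bool \<Rightarrow> real \<Rightarrow> real \<Rightarrow> bool" where
  "tail_rel e x y \<longleftrightarrow> (\<exists>i j. cf_rem x i = cf_rem y j \<and> (even (i + j) \<longleftrightarrow> e))"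

lemma tail_relI: "cf_rem x i = cf_rem y j \<Longrightarrow> (even (i + j) \<longleftrightarrow> e) \<Longrightarrow> tail_rel e x y"
  unfolding tail_rel_def by blast

lemma tail_rel_sym: "tail_rel e x y \<Longrightarrow> tail_rel e y x"
  unfolding tail_rel_def by (metis add.commute)

lemma tail_rel_trans:
  assumes "tail_rel e x y" "tail_rel e' y z"
  shows "tail_rel (e = e') x z"
proof -
  obtain i j where ij: "cf_rem x i = cf_rem y j" "even (i + j) \<longleftrightarrow> e"
    using assms unfolding tail_rel_def by blast
  obtain k l where kl: "cf_rem y k = cf_rem z l" "even (k + l) \<longleftrightarrow> e'"
    using assms unfolding tail_rel_def by blast
  have "cf_rem x (i + k) = cf_rem y (k + j)" by (simp add: cf_rem_add ij flip: add.commute[of j k])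
  also have "\<dots> = cf_rem z (l + j)" by (simp add: cf_rem_add kl)
  finally show ?thesis using ij(2) kl(2) by (intro tail_relI) auto
qed

lemma tail_rel_add_int: "tail_rel True (x + of_int b) x"
  by (rule tail_relI[of _ 1 _ 1]) auto

text \<open>For \<open>0 < t < 1/2\<close> with \<open>x = a + t\<close>, the expansion of \<open>- x\<close> starts with \<open>- a - 1\<close> and \<open>1\<close>, and its
  next complete quotient is \<open>1 / t - 1\<close>. So it joins the expansion of \<open>x\<close> one step later than
  \<open>x\<close> itself: index \<open>3\<close> meets index \<open>2\<close>. The case \<open>t > 1/2\<close> follows by exchanging \<open>x\<close> and \<open>- x\<close>.\<close>

lemma tail_rel_minus:
  assumes "x \<notin> \<rat>"
  shows "tail_rel False (- x) x"
proof -
  have small: "tail_rel False (- y) y" if y: "y \<notin> \<rat>" "frac y < 1 / 2" for y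
  proof -
    define t where "t = frac y"
    have t: "0 < t" "t < 1 / 2" using frac_irrational[of y] y unfolding t_def by auto
    have "y \<notin> \<int>" using y by (metis Ints_cases Rats_of_int)
    then have "frac (- y) = 1 - t" unfolding t_def by (simp add: frac_neg)
    then have "cf_rem (- y) 1 = 1 / (1 - t)" by simp
    moreover have "frac (1 / (1 - t)) = t / (1 - t)"
      using t by (subst frac_unique_iff) (auto simp: field_simps)
    ultimately have "cf_rem (- y) 2 = (1 - t) / t" by (simp add: numeral_2_eq_2)
    also have "\<dots> = cf_rem y 1 - 1" using t by (simp add: field_simps t_def)
    finally have "cf_rem (- y) 2 = cf_rem y 1 + of_int (- 1)" by simp
    then have "cf_rem (- y) 3 = cf_rem y 2"
      by (simp add: numeral_2_eq_2 numeral_3_eq_3 del: of_int_minus)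
    then show ?thesis by (rule tail_relI) simp
  qed
  show ?thesis
  proof (cases "frac x < 1 / 2")
    case True
    then show ?thesis using small assms by blast
  next
    case False
    have "x \<notin> \<int>" using assms by (metis Ints_cases Rats_of_int)
    then have "frac (- x) = 1 - frac x" by (simp add: frac_neg)
    moreover have "frac x \<noteq> 1 / 2"
      using assms Rats_frac_iff[of x] Rats_divide[of 1 2] by (metis Rats_1 Rats_number_of)
    ultimately have "frac (- x) < 1 / 2" using False by linarith
    then have "tail_rel False (- (- x)) (- x)" using assms by (intro small) auto
    then show ?thesis by (auto intro: tail_rel_sym)
  qed
qed

lemma tail_rel_inverse:
  assumes "x \<notin> \<rat>"
  shows "tail_rel False (1 / x) x"
proof -
  have gt1: "tail_rel False (1 / y) y" if "y > 1" for y
  proof -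
    have "frac (1 / y) = 1 / y" using that by (subst frac_eq) auto
    then have "cf_rem (1 / y) 1 = cf_rem y 0" by simp
    then show ?thesis by (rule tail_relI) simp
  qed
  have pos: "tail_rel False (1 / y) y" if "y > 0" "y \<notin> \<rat>" for y
  proof (cases "y > 1")
    case False
    moreover have "y \<noteq> 1" using that by auto
    ultimately have "1 / y > 1" using that by simp
    from gt1[OF this] show ?thesis by (auto intro: tail_rel_sym)
  qed (rule gt1)
  show ?thesis
  proof (cases "x > 0")
    case False
    moreover have "x \<noteq> 0" using assms by auto
    ultimately have "tail_rel False (1 / - x) (- x)" using assms by (intro pos) auto
    moreover have "tail_rel False (1 / x) (- (1 / x))"
      using tail_rel_minus[of "1 / x"] assms by (auto intro: tail_rel_sym simp: Rats_inverse_iff)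
    ultimately have "tail_rel True (1 / x) (- x)" using tail_rel_trans[of False _ _ False] by simp
    from tail_rel_trans[OF this tail_rel_minus[OF assms]] show ?thesis by simp
  qed (use pos assms in blast)
qed

section \<open>Moebius equivalence and Serret's theorem\<close>

text \<open>Here the flag is the sign of the determinant of the integer matrix that maps \<open>y\<close> to \<open>x\<close>. Clearing
  the denominator avoids a side condition: it cannot vanish for irrational \<open>y\<close>.\<close>

definition mobius_rel :: "bool \<Rightarrow> real \<Rightarrow> real \<Rightarrow> bool" where
  "mobius_rel e x y \<longleftrightarrow> (\<exists>a b c d :: int. a * d - b * c = (if e then 1 else - 1) \<and>
     x * (of_int c * y + of_int d) = of_int a * y + of_int b)"

lemma mobius_relI:
  "a * d - b * c = (if e then 1 else - 1) \<Longrightarrow>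
    x * (of_int c * y + of_int d) = of_int a * y + of_int b \<Longrightarrow> mobius_rel e x y"
  unfolding mobius_rel_def by blast

lemma mobius_rel_sym:
  assumes "mobius_rel e x y" shows "mobius_rel e y x"
proof -
  obtain a b c d where "a * d - b * c = (if e then 1 else - 1)"
     "x * (of_int c * y + of_int d) = of_int a * y + of_int b"
    using assms unfolding mobius_rel_def by blast
  then show ?thesis
    by (intro mobius_relI[of d a "- b" "- c"]) (auto simp: algebra_simps)
qed

lemma mobius_rel_trans:
  assumes "mobius_rel e x y" "mobius_rel e' y z" shows "mobius_rel (e = e') x z"
proof -
  obtain a b c d where 1: "a * d - b * c = (if e then 1 else - 1)"
     "x * (of_int c * y + of_int d) = of_int a * y + of_int b"
    using assms unfolding mobius_rel_def by blast
  obtain a' b' c' d' where 2: "a' * d' - b' * c' = (if e' then 1 else - 1)"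
     "y * (of_int c' * z + of_int d') = of_int a' * z + of_int b'"
    using assms unfolding mobius_rel_def by blast
  show ?thesis
  proof (rule mobius_relI[of "a * a' + b * c'" "c * b' + d * d'" "a * b' + b * d'" "c * a' + d * c'"])
    have "(a * a' + b * c') * (c * b' + d * d') - (a * b' + b * d') * (c * a' + d * c')
       = (a * d - b * c) * (a' * d' - b' * c')" by (simp add: algebra_simps)
    then show "(a * a' + b * c') * (c * b' + d * d') - (a * b' + b * d') * (c * a' + d * c')
       = (if e = e' then 1 else - 1)" using 1(1) 2(1) by simp
    have "x * (of_int c * y + of_int d) * (of_int c' * z + of_int d')
        = (of_int a * y + of_int b) * (of_int c' * z + of_int d')" by (simp add: 1)
    then have "x * (of_int c * (y * (of_int c' * z + of_int d')) + of_int d * (of_int c' * z + of_int d'))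
        = of_int a * (y * (of_int c' * z + of_int d')) + of_int b * (of_int c' * z + of_int d')"
      by (simp add: algebra_simps)
    then show "x * (of_int (c * a' + d * c') * z + of_int (c * b' + d * d')) =
       of_int (a * a' + b * c') * z + of_int (a * b' + b * d')"
      unfolding 2(2) by (simp add: algebra_simps)
  qed
qed

text \<open>Moving both points by matrices of the same determinant does not change the determinants of the
  matrices that connect them. This replaces a number and its conjugate by a complete
  quotient and its conjugate.\<close>

lemma mobius_rel_cong:
  assumes "mobius_rel e x y" "mobius_rel e x' y'"
  shows "mobius_rel b x' x \<longleftrightarrow> mobius_rel b y' y"
proof -
  have "mobius_rel b x' x" if "mobius_rel e x y" "mobius_rel e x' y'" "mobius_rel b y' y" for x x' y y'
    using mobius_rel_trans[OF mobius_rel_trans[OF that(2,3)] mobius_rel_sym[OF that(1)]]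
    by (cases e) auto
  then show ?thesis using assms mobius_rel_sym by blast
qed

lemma mobius_rel_minus: "mobius_rel False (- x) x"
  by (rule mobius_relI[of "- 1" 1 0 0]) auto

lemma mobius_rel_neg_inverse: "x \<noteq> 0 \<Longrightarrow> mobius_rel True (- 1 / x) x"
  by (rule mobius_relI[of 0 0 "- 1" 1]) auto

lemma mobius_rel_inverse: "x \<noteq> 0 \<Longrightarrow> mobius_rel False (1 / x) x"
  by (rule mobius_relI[of 0 0 1 1]) auto

lemma mobius_rel_inverse_shift: "x \<noteq> of_int q \<Longrightarrow> mobius_rel False x (1 / (x - of_int q))"
  by (rule mobius_relI[of q 0 1 1]) (auto simp: field_simps)

lemma mobius_rel_refl: "mobius_rel True x x"
  by (rule mobius_relI[of 1 1 0 0]) auto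

lemma mobius_rel_cf_rem:
  assumes "x \<notin> \<rat>" shows "mobius_rel (even i) x (cf_rem x i)"
proof (induction i)
  case (Suc i)
  have "cf_rem x i \<noteq> of_int \<lfloor>cf_rem x i\<rfloor>"
    using irrational_cf_rem[OF assms, of i] by (metis Rats_of_int)
  then have "mobius_rel False (cf_rem x i) (cf_rem x (Suc i))"
    using mobius_rel_inverse_shift by (simp add: frac_def)
  from mobius_rel_trans[OF Suc this] show ?case by simp
qed (simp add: mobius_rel_refl)

text \<open>Euclid's algorithm on the left column \<open>(a, c)\<close> of the matrix: subtracting \<open>a div c\<close> from \<open>x\<close>
  and inverting yields a matrix with lower left entry \<open>a mod c\<close> and opposite determinant. Translation,
  inversion and negation change the parity of the tail exactly as they change the determinant.\<close>

lemma tail_rel_if_mobius: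
  assumes "y \<notin> \<rat>" "x \<notin> \<rat>" "a * d - b * c = (if e then 1 else - 1)"
    "x * (of_int c * y + of_int d) = of_int a * y + of_int b"
  shows "tail_rel e x y"
  using assms(2-)
proof (induction "nat \<bar>c\<bar>" arbitrary: a b c d e x rule: less_induct)
  case less
  show ?case
  proof (cases "c = 0")
    case True
    then have ad: "a * d = (if e then 1 else - 1)" using less.prems by simp
    have d2: "d = 1 \<or> d = - 1"
    proof -
      have "d dvd 1" using ad by (metis dvd_minus_iff dvd_triv_right)
      then show ?thesis by (auto simp: zdvd1_eq)
    qed
    then have a: "a = (if e then d else - d)" using ad by (auto split: if_splits)
    have x: "x = (if e then y else - y) + of_int (d * b)"
      using less.prems(3) True d2 a by (auto split: if_splits)
    have "tail_rel e (if e then y else - y) y"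
      using tail_rel_minus[OF assms(1)] tail_rel_add_int[of y 0] by simp
    from tail_rel_trans[OF tail_rel_add_int[of _ "d * b"] this] show ?thesis
      unfolding x by (simp only: simp_thms)
  next
    case False
    define q r s where "q = a div c" and "r = a mod c" and "s = b - q * d"
    have rq: "a = q * c + r" unfolding q_def r_def by simp
    define w where "w = 1 / (x - of_int q)"
    have ne: "x \<noteq> of_int q" using less.prems(1) Rats_of_int by blast
    have xw: "x - of_int q = 1 / w" unfolding w_def by simp
    have "x - of_int q \<notin> \<rat>" using less.prems(1) Rats_add[of "x - of_int q" "of_int q"] by auto
    then have wR: "w \<notin> \<rat>" unfolding w_def by (simp add: Rats_inverse_iff)
    have "(x - of_int q) * (of_int c * y + of_int d) = of_int r * y + of_int s"
      using less.prems(3) unfolding rq s_def by (simp add: algebra_simps)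
    then have w: "w * (of_int r * y + of_int s) = of_int c * y + of_int d"
      using ne unfolding w_def by (simp add: field_simps)
    have "tail_rel (\<not> e) w y"
    proof (rule less.hyps[of r w c s d "\<not> e"])
      show "nat \<bar>r\<bar> < nat \<bar>c\<bar>" using False abs_mod_less[of c a] unfolding r_def by simp
      show "c * s - d * r = (if \<not> e then 1 else - 1)"
        using less.prems(2) unfolding rq s_def by (auto simp: algebra_simps split: if_splits)
    qed (use wR w in auto)
    from tail_rel_trans[OF tail_rel_inverse[OF wR] this]
    have "tail_rel e (x - of_int q) y" unfolding xw by simp
    from tail_rel_trans[OF tail_rel_add_int[of _ q] this] show ?thesis by simp
  qed
qed

text \<open>Serret's theorem, refined so that the determinant is read off from the parities of the indices.\<close>

theorem tail_rel_iff_mobius_rel: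
  assumes "x \<notin> \<rat>" "y \<notin> \<rat>"
  shows "tail_rel e x y \<longleftrightarrow> mobius_rel e x y"
proof
  assume "tail_rel e x y"
  then obtain i j where ij: "cf_rem x i = cf_rem y j" "even (i + j) \<longleftrightarrow> e"
    unfolding tail_rel_def by blast
  have "mobius_rel (even i = even j) x y"
    using mobius_rel_trans[OF mobius_rel_cf_rem[OF assms(1), of i], unfolded ij(1),
      OF mobius_rel_sym[OF mobius_rel_cf_rem[OF assms(2), of j]]] .
  moreover have "(even i = even j) = e" using ij by auto
  ultimately show "mobius_rel e x y" by simp
next
  assume "mobius_rel e x y"
  then show "tail_rel e x y"
    unfolding mobius_rel_def using tail_rel_if_mobius[OF assms(2,1)] by blast
qed

section \<open>Quadratic forms and their roots\<close>

lemma sqrt_nonsquare_irrational: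
  assumes "D > 0" "\<not> is_square (D :: int)"
  shows "sqrt (of_int D) \<notin> \<rat>"
proof
  assume "sqrt (of_int D) \<in> \<rat>"
  then obtain p q :: nat where pq: "q \<noteq> 0" "\<bar>sqrt (of_int D)\<bar> = real p / real q" "coprime p q"
    using Rats_abs_nat_div_natE by blast
  have "real_of_int D = (real p / real q)\<^sup>2"
    using pq(2) assms(1) by (metis abs_ge_zero less_eq_real_def of_int_0_less_iff power2_abs real_sqrt_pow2)
  then have "real_of_int (D * int q ^ 2) = real_of_int (int p ^ 2)"
    using pq(1) by (simp add: field_simps)
  then have eq: "D * int q ^ 2 = int p ^ 2" by (simp only: of_int_eq_iff)
  then have "int q ^ 2 dvd int p ^ 2" by (metis dvd_triv_right)
  then have "q dvd p" by simp
  then have "q = 1" using pq(3) by (metis coprime_absorb_right is_unit_gcd nat_dvd_1_iff_1 coprime_commute)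
  then have "D = int p ^ 2" using eq by simp
  then show False using assms(2) by (auto intro: is_nth_powerI)
qed

text \<open>The coefficients of the form \<open>f(a x + b y, c x + d y)\<close>.\<close>

fun form_sub :: "int \<Rightarrow> int \<Rightarrow> int \<Rightarrow> int \<Rightarrow> qform \<Rightarrow> qform" where
  "form_sub a b c d (m, n, k) = (m * a\<^sup>2 + n * c\<^sup>2 + k * a * c, m * b\<^sup>2 + n * d\<^sup>2 + k * b * d,
     2 * m * a * b + 2 * n * c * d + k * (a * d + b * c))"

lemma form_eval_sub:
  "form_eval (form_sub a b c d f) x y = form_eval f (a * x + b * y) (c * x + d * y)"
  by (cases f) (simp add: power2_eq_square algebra_simps)

lemma form_eval_inject:
  assumes "\<And>x y. form_eval f x y = form_eval g x y" shows "f = g"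
proof -
  obtain m n k m' n' k' where fg: "f = (m, n, k)" "g = (m', n', k')" by (metis prod_cases3)
  show ?thesis using assms[of 1 0] assms[of 0 1] assms[of 1 1] unfolding fg by simp
qed

lemma form_class_eq_subs: "form_class f = {form_sub a b c d f |a b c d. a * d - b * c = 1}"
proof -
  have "(\<forall>x y. form_eval g x y = form_eval f (a * x + b * y) (c * x + d * y)) \<longleftrightarrow> g = form_sub a b c d f"
    for g a b c d
    using form_eval_inject[of g "form_sub a b c d f"] by (auto simp: form_eval_sub)
  then show ?thesis unfolding form_class_def by auto
qed

text \<open>With \<open>s = \<plusminus>\<surd>D\<close> for the discriminant \<open>D\<close>, the sign of \<open>s\<close> selects one of the two roots of
  \<open>f(x, 1)\<close> without a division: \<open>s\<close> is the derivative of \<open>f(x, 1)\<close> at that root.\<close>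

fun form_root :: "real \<Rightarrow> qform \<Rightarrow> real \<Rightarrow> bool" where
  "form_root s (m, n, k) x \<longleftrightarrow>
     s\<^sup>2 = of_int (k\<^sup>2 - 4 * m * n) \<and> 2 * of_int m * x + of_int k = s"

lemma form_root_irrational: "form_root s f x \<Longrightarrow> s \<notin> \<rat> \<Longrightarrow> x \<notin> \<rat>"
  by (cases f) auto

lemma form_root_nonzero: "form_root s (m, n, k) x \<Longrightarrow> s \<notin> \<rat> \<Longrightarrow> m \<noteq> 0"
  by auto

lemma form_root_zero:
  assumes "form_root s (m, n, k) x" "s \<notin> \<rat>"
  shows "of_int m * x\<^sup>2 + of_int k * x + of_int n = 0"
proof -
  have "(2 * of_int m * x + of_int k)\<^sup>2 = of_int k ^ 2 - 4 * of_int m * of_int n"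
    using assms(1) by simp
  then have "4 * of_int m * (of_int m * x\<^sup>2 + of_int k * x + of_int n) = 0" by algebra
  then show ?thesis using form_root_nonzero[OF assms] by simp
qed

text \<open>An irrational root together with the root of its discriminant determines the form, because
  \<open>2 m x + k = s\<close> fixes both \<open>m\<close> and \<open>k\<close> and the discriminant then
  gives \<open>n\<close>.\<close>

lemma form_root_inject:
  assumes "form_root s f x" "form_root s g x" "s \<notin> \<rat>"
  shows "f = g"
proof -
  obtain m n k m' n' k' where fg: "f = (m, n, k)" "g = (m', n', k')" by (metis prod_cases3)
  have x: "x \<notin> \<rat>" using form_root_irrational assms by blast
  have eq: "2 * of_int (m - m') * x = of_int (k' - k)" using assms unfolding fg by (simp add: algebra_simps)
  have m: "m = m'"
  proof (rule ccontr)
    assume "m \<noteq> m'"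
    then have "x = of_int (k' - k) / of_int (2 * (m - m'))" using eq by (simp add: field_simps)
    then show False using x by (metis Rats_divide Rats_of_int)
  qed
  then have k: "k = k'" using eq by simp
  have "real_of_int (k\<^sup>2 - 4 * m * n) = of_int (k'\<^sup>2 - 4 * m' * n')" using assms unfolding fg by simp
  then have "k\<^sup>2 - 4 * m * n = k'\<^sup>2 - 4 * m' * n'" by (simp only: of_int_eq_iff)
  then show ?thesis using m k form_root_nonzero[OF assms(1)[unfolded fg] assms(3)] unfolding fg by simp
qed

lemma form_root_inject_root:
  assumes "form_root s f x" "form_root s f y" "s \<notin> \<rat>" shows "x = y"
  using assms form_root_nonzero by (cases f) fastforce

fun form_scale :: "int \<Rightarrow> qform \<Rightarrow> qform" where
  "form_scale e (m, n, k) = (e * m, e * n, e * k)"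

lemma linear_form_nonzero:
  assumes "x \<notin> \<rat>" "c \<noteq> 0 \<or> d \<noteq> 0"
  shows "of_int c * x + of_int d \<noteq> 0"
proof
  assume 0: "of_int c * x + of_int d = 0"
  then have "c \<noteq> 0" using assms(2) by auto
  then have "x = - of_int d / of_int c" using 0 by (simp add: field_simps eq_neg_iff_add_eq_0)
  then show False using assms(1) by auto
qed

text \<open>Substitution moves roots by the inverse matrix. A determinant of \<open>- 1\<close> would also exchange the two
  roots; the extra sign on the form undoes this, so that matrices of both determinants act on
  roots compatibly with the choice of \<open>s\<close>, hence with conjugation.\<close>

lemma form_root_sub:
  assumes "form_root s f y" "s \<notin> \<rat>" "a * d - b * c = e" "e = 1 \<or> e = - 1"
    "y * (of_int c * x + of_int d) = of_int a * x + of_int b"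
  shows "form_root s (form_scale e (form_sub a b c d f)) x"
proof -
  obtain m n k where f: "f = (m, n, k)" by (metis prod_cases3)
  define a' b' c' d' m' n' k' e' where defs: "a' = real_of_int a" "b' = real_of_int b" "c' = real_of_int c"
    "d' = real_of_int d" "m' = real_of_int m" "n' = real_of_int n" "k' = real_of_int k" "e' = real_of_int e"
  have det: "a' * d' - b' * c' = e'"
    unfolding defs using arg_cong[OF assms(3), of real_of_int] by simp
  have e2: "e' * e' = 1" unfolding defs using assms(4) by auto
  have y: "y \<notin> \<rat>" using form_root_irrational assms by blast
  have q: "m' * y\<^sup>2 + k' * y + n' = 0" unfolding defs using form_root_zero[of s m n k y] assms f by auto
  have s: "s = 2 * m' * y + k'" unfolding defs using assms(1) f by auto
  have D: "s\<^sup>2 = k'\<^sup>2 - 4 * m' * n'" unfolding defs using assms(1) f by auto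
  have ne: "a' - c' * y \<noteq> 0"
  proof -
    have "- c \<noteq> 0 \<or> a \<noteq> 0" using assms(3,4) by auto
    from linear_form_nonzero[OF y this] show ?thesis unfolding defs by simp
  qed
  have x: "x * (a' - c' * y) = d' * y - b'" using assms(5) unfolding defs by (simp add: algebra_simps)
  have "(2 * (e' * (m' * a'\<^sup>2 + n' * c'\<^sup>2 + k' * a' * c')) * x
      + e' * (2 * m' * a' * b' + 2 * n' * c' * d' + k' * (a' * d' + b' * c'))) * (a' - c' * y)
    = e' * (2 * (m' * a'\<^sup>2 + n' * c'\<^sup>2 + k' * a' * c') * (x * (a' - c' * y))
      + (2 * m' * a' * b' + 2 * n' * c' * d' + k' * (a' * d' + b' * c')) * (a' - c' * y))"
    by (simp add: algebra_simps)
  also have "\<dots> = e' * (a' * d' - b' * c') * (2 * m' * y + k') * (a' - c' * y)"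
    unfolding x using q by algebra
  also have "\<dots> = s * (a' - c' * y)" using det e2 s by simp
  finally have 1: "2 * (e' * (m' * a'\<^sup>2 + n' * c'\<^sup>2 + k' * a' * c')) * x
      + e' * (2 * m' * a' * b' + 2 * n' * c' * d' + k' * (a' * d' + b' * c')) = s"
    using ne by simp
  have "(e' * (2 * m' * a' * b' + 2 * n' * c' * d' + k' * (a' * d' + b' * c')))\<^sup>2
      - 4 * (e' * (m' * a'\<^sup>2 + n' * c'\<^sup>2 + k' * a' * c')) * (e' * (m' * b'\<^sup>2 + n' * d'\<^sup>2 + k' * b' * d'))
     = (e' * e') * (a' * d' - b' * c')\<^sup>2 * (k'\<^sup>2 - 4 * m' * n')"
    by (simp add: power2_eq_square algebra_simps)
  also have "\<dots> = s\<^sup>2" using det e2 D by (simp add: power2_eq_square)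
  finally show ?thesis using 1 unfolding f defs by simp
qed

lemma form_scale_1 [simp]: "form_scale 1 f = f"
  by (cases f) simp

text \<open>The dictionary between classes and numbers. If a matrix of determinant \<open>1\<close> connects the roots,
  then \<open>g\<close> and the substituted form \<open>f\<close> share a root and a discriminant, so they coincide.\<close>

lemma form_class_iff_mobius_rel:
  assumes "form_root s f y" "form_root s g x" "s \<notin> \<rat>"
  shows "g \<in> form_class f \<longleftrightarrow> mobius_rel True x y"
proof
  assume "g \<in> form_class f"
  then obtain a b c d where det: "a * d - b * c = 1" and g: "g = form_sub a b c d f"
    unfolding form_class_eq_subs by blast
  have y: "y \<notin> \<rat>" using form_root_irrational assms by blast
  define z where "z = (of_int d * y - of_int b) / (of_int a - of_int c * y)"
  have ne: "of_int a - of_int c * y \<noteq> 0"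
  proof -
    have "- c \<noteq> 0 \<or> a \<noteq> 0" using det by auto
    from linear_form_nonzero[OF y this] show ?thesis by simp
  qed
  then have z: "z * (of_int a - of_int c * y) = of_int d * y - of_int b" unfolding z_def by simp
  then have "y * (of_int c * z + of_int d) = of_int a * z + of_int b" by (simp add: algebra_simps)
  then have "form_root s g z" using form_root_sub[OF assms(1,3) det] g by simp
  then have "x = z" using form_root_inject_root assms by blast
  then show "mobius_rel True x y"
    using z det by (intro mobius_relI[of d a "- b" "- c"]) (auto simp: algebra_simps)
next
  assume "mobius_rel True x y"
  then have "mobius_rel True y x" by (rule mobius_rel_sym)
  then obtain a b c d where det: "a * d - b * c = 1" and
    "y * (of_int c * x + of_int d) = of_int a * x + of_int b"
    unfolding mobius_rel_def by auto
  then have "form_root s (form_sub a b c d f) x" using form_root_sub[OF assms(1,3) det] by simp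
  then have "g = form_sub a b c d f" using form_root_inject assms by blast
  then show "g \<in> form_class f" unfolding form_class_eq_subs using det by blast
qed

section \<open>Algebraic conjugates and Lagrange's theorem\<close>

definition conj_roots :: "real \<Rightarrow> real \<Rightarrow> real \<Rightarrow> bool" where
  "conj_roots s x x' \<longleftrightarrow> (\<exists>f. form_root s f x \<and> form_root (- s) f x')"

lemma conj_roots_irrational:
  assumes "conj_roots s x x'" "s \<notin> \<rat>" shows "x \<notin> \<rat>" "x' \<notin> \<rat>"
  using assms form_root_irrational[of s _ x] form_root_irrational[of "- s" _ x']
  unfolding conj_roots_def by (blast, metis Rats_minus_iff)

lemma conj_roots_unique:
  "conj_roots s x x' \<Longrightarrow> conj_roots s x x'' \<Longrightarrow> s \<notin> \<rat> \<Longrightarrow> x' = x''"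
  unfolding conj_roots_def
  by (metis form_root_inject form_root_inject_root Rats_minus_iff)

lemma conj_roots_neq:
  assumes "conj_roots s x x'" "s \<notin> \<rat>" shows "x \<noteq> x'"
proof
  assume "x = x'"
  then obtain f where "form_root s f x" "form_root (- s) f x" using assms unfolding conj_roots_def by blast
  then have "s = - s" by (cases f) auto
  then show False using assms(2) by simp
qed

lemma conj_roots_mobius:
  assumes "conj_roots s y y'" "s \<notin> \<rat>" "a * d - b * c = 1 \<or> a * d - b * c = - 1"
    "y * (of_int c * x + of_int d) = of_int a * x + of_int b"
    "y' * (of_int c * x' + of_int d) = of_int a * x' + of_int b"
  shows "conj_roots s x x'"
proof -
  obtain f where "form_root s f y" "form_root (- s) f y'"
    using assms(1) unfolding conj_roots_def by blast
  then show ?thesis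
    using form_root_sub[OF _ _ refl assms(3,4)] form_root_sub[OF _ _ refl assms(3,5)] assms(2)
    unfolding conj_roots_def by (metis Rats_minus_iff)
qed

lemma conj_roots_minus: "conj_roots s y y' \<Longrightarrow> s \<notin> \<rat> \<Longrightarrow> conj_roots s (- y) (- y')"
  by (rule conj_roots_mobius[of _ _ _ "- 1" 1 0 0]) auto

text \<open>For a reduced pair the product of the roots is negative, so \<open>m n < 0\<close> and \<open>D = k\<^sup>2 + 4 \<bar>m n\<bar>\<close>
  bounds \<open>\<bar>m\<bar>\<close> and \<open>\<bar>k\<bar>\<close>.\<close>

lemma finite_reduced:
  assumes "s \<notin> \<rat>"
  shows "finite {x. \<exists>x'. conj_roots s x x' \<and> 1 < x \<and> - 1 < x' \<and> x' < 0}"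
proof -
  let ?B = "{- \<lfloor>s\<^sup>2\<rfloor>..\<lfloor>s\<^sup>2\<rfloor>}"
  have "{x. \<exists>x'. conj_roots s x x' \<and> 1 < x \<and> - 1 < x' \<and> x' < 0}
     \<subseteq> (\<lambda>(m, k). (s - of_int k) / (2 * of_int m)) ` (?B \<times> ?B)"
  proof safe
    fix x x' assume "conj_roots s x x'" and red: "1 < x" "- 1 < x'" "x' < 0"
    then obtain m n k where f: "form_root s (m, n, k) x" "form_root (- s) (m, n, k) x'"
      unfolding conj_roots_def by (metis prod_cases3)
    have m: "m \<noteq> 0" using form_root_nonzero f(1) assms by blast
    have sums: "of_int m * (x + x') = - of_int k" using f by (simp add: algebra_simps)
    have q: "of_int m * x\<^sup>2 + of_int k * x + of_int n = 0" using form_root_zero f(1) assms by blast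
    have n: "of_int n = of_int m * (x * x')" using q sums by algebra
    have "real_of_int m * of_int n = of_int m ^ 2 * (x * x')" using n by (simp add: power2_eq_square)
    also have "\<dots> < 0" using m red by (intro mult_pos_neg) (auto simp: mult_pos_neg)
    finally have "real_of_int (m * n) < of_int 0" by simp
    then have mn: "m * n < 0" by (simp only: of_int_less_iff)
    have D: "s\<^sup>2 = of_int (k\<^sup>2 - 4 * m * n)" using f(1) by simp
    then have fl: "\<lfloor>s\<^sup>2\<rfloor> = k\<^sup>2 - 4 * m * n" by (simp only: floor_of_int)
    have "\<bar>k\<bar> * 1 \<le> \<bar>k\<bar> * \<bar>k\<bar>" by (cases "k = 0") (simp, intro mult_left_mono, auto)
    then have "\<bar>k\<bar> * 1 \<le> k\<^sup>2" by (simp add: power2_eq_square)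
    moreover have "\<bar>m\<bar> * 1 \<le> \<bar>m\<bar> * \<bar>n\<bar>" using mn by (intro mult_left_mono) (auto simp: mult_less_0_iff)
    moreover have "\<bar>m\<bar> * \<bar>n\<bar> = - (m * n)" using mn by (simp flip: abs_mult)
    moreover have "0 \<le> k\<^sup>2" by simp
    ultimately have "\<bar>k\<bar> \<le> \<lfloor>s\<^sup>2\<rfloor>" "\<bar>m\<bar> \<le> \<lfloor>s\<^sup>2\<rfloor>" using mn unfolding fl by (simp_all add: mult.assoc)
    then have "k \<in> ?B" "m \<in> ?B" by auto
    moreover have "x = (s - of_int k) / (2 * of_int m)" using f(1) m by (simp add: field_simps)
    ultimately show "x \<in> (\<lambda>(m, k). (s - of_int k) / (2 * of_int m)) ` (?B \<times> ?B)" by force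
  qed
  then show ?thesis by (rule finite_subset) simp
qed

text \<open>The conjugates of the complete quotients of \<open>x\<close>: the digits subtracted are those of \<open>x\<close>, not
  those of \<open>x'\<close>.\<close>

primrec cf_conj :: "real \<Rightarrow> real \<Rightarrow> nat \<Rightarrow> real" where
  "cf_conj x x' 0 = x'"
| "cf_conj x x' (Suc i) = 1 / (cf_conj x x' i - of_int (cf_coeff x i))"

lemma conj_roots_cf:
  assumes "conj_roots s x x'" "s \<notin> \<rat>"
  shows "conj_roots s (cf_rem x i) (cf_conj x x' i)"
proof (induction i)
  case (Suc i)
  have "cf_rem x i \<noteq> of_int (cf_coeff x i)" "cf_conj x x' i \<noteq> of_int (cf_coeff x i)"
    using conj_roots_irrational[OF Suc assms(2)] Rats_of_int by metis+
  then show ?case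
    by (intro conj_roots_mobius[OF Suc assms(2), of "cf_coeff x i" 0 1 1])
       (auto simp: field_simps frac_def cf_coeff_def)
qed (simp add: assms)

lemma mobius_rel_cf_conj:
  assumes "conj_roots s x x'" "s \<notin> \<rat>"
  shows "mobius_rel (even i) x' (cf_conj x x' i)"
proof (induction i)
  case (Suc i)
  have "cf_conj x x' i \<noteq> of_int (cf_coeff x i)"
    using conj_roots_irrational[OF conj_roots_cf[OF assms] assms(2)] Rats_of_int by metis
  from mobius_rel_trans[OF Suc mobius_rel_inverse_shift[OF this]] show ?case by simp
qed (simp add: mobius_rel_refl)

text \<open>Once a conjugate is negative, the next one lies in \<open>(-1, 0)\<close>, and so do all later ones. If no
  conjugate after the first were negative, then each of them would exceed the
  corresponding partial quotient of \<open>x\<close> by less than \<open>1\<close>. Then \<open>cf_rem x 1\<close> and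
  its conjugate would have the same digits, hence be equal, which is impossible.\<close>

lemma cf_conj_eventually_reduced:
  assumes "conj_roots s x x'" "s \<notin> \<rat>"
  obtains N where "\<And>i. i \<ge> N \<Longrightarrow> 1 < cf_rem x i \<and> - 1 < cf_conj x x' i \<and> cf_conj x x' i < 0"
proof -
  have irr: "x \<notin> \<rat>" "cf_conj x x' i \<notin> \<rat>" for i
    using assms conj_roots_irrational conj_roots_cf by blast+
  have neg: "- 1 < cf_conj x x' (Suc (Suc i)) \<and> cf_conj x x' (Suc (Suc i)) < 0"
    if "cf_conj x x' (Suc i) < 0" for i
  proof -
    have "cf_conj x x' (Suc i) - of_int (cf_coeff x (Suc i)) < - 1"
      using that cf_coeff_Suc_ge_1[OF irr(1), of i] by linarith
    then show ?thesis by (subst (1 2) cf_conj.simps(2)) (simp add: field_simps del: cf_conj.simps)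
  qed
  have "\<exists>i. cf_conj x x' (Suc i) < 0"
  proof (rule ccontr)
    assume "\<not> ?thesis"
    moreover have "cf_conj x x' i \<noteq> 0" for i using irr(2)[of i] by auto
    ultimately have pos: "cf_conj x x' (Suc i) > 0" for i by (metis linorder_neqE_linordered_idom)
    have gt: "cf_conj x x' (Suc i) > of_int (cf_coeff x (Suc i))" for i
      using pos[of "Suc i"] by (subst (asm) cf_conj.simps(2)) simp
    have lt: "cf_conj x x' (Suc i) < of_int (cf_coeff x (Suc i)) + 1" for i
    proof -
      have "1 < cf_conj x x' (Suc (Suc i))" using gt[of "Suc i"] cf_coeff_Suc_ge_1[OF irr(1), of "Suc i"] by linarith
      then show ?thesis using gt[of i] by (subst (asm) cf_conj.simps(2)) (simp add: field_simps del: cf_conj.simps)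
    qed
    have fl: "\<lfloor>cf_conj x x' (Suc i)\<rfloor> = cf_coeff x (Suc i)" for i
      using gt[of i] lt[of i] by linarith
    have rem: "cf_rem (cf_conj x x' 1) i = cf_conj x x' (Suc i)" for i
    proof (induction i)
      case (Suc i)
      then show ?case using fl[of i] by (simp add: frac_def del: cf_conj.simps(2)) (simp only: cf_conj.simps(2))
    qed simp
    have "cf_rem x 1 = cf_conj x x' 1"
    proof (rule cf_coeff_inject)
      fix i show "cf_coeff (cf_rem x 1) i = cf_coeff (cf_conj x x' 1) i"
        unfolding cf_coeff_cf_rem using fl[of i] rem[of i] by (simp add: cf_coeff_def)
    qed (use irr irrational_cf_rem in blast)+
    then show False using conj_roots_neq[OF conj_roots_cf[OF assms, of 1] assms(2)] by simp
  qed
  then obtain i0 where i0: "cf_conj x x' (Suc i0) < 0" by blast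
  have "- 1 < cf_conj x x' (Suc (Suc i)) \<and> cf_conj x x' (Suc (Suc i)) < 0" if "i \<ge> i0" for i
    using that
  proof (induction i rule: dec_induct)
    case base
    then show ?case using neg[OF i0] .
  next
    case (step i)
    then show ?case using neg by blast
  qed
  then have "1 < cf_rem x i \<and> - 1 < cf_conj x x' i \<and> cf_conj x x' i < 0" if "i \<ge> i0 + 2" for i
    using that cf_rem_Suc_gt_1[OF irr(1)]
    by (metis add_2_eq_Suc' Suc_le_D Suc_le_mono)
  then show thesis using that by blast
qed

text \<open>Lagrange's theorem: there are only finitely many reduced complete quotients, so one recurs.\<close>

theorem cf_rem_eventually_periodic:
  assumes "conj_roots s x x'" "s \<notin> \<rat>"
  obtains i d where "d > 0" "cf_rem x (i + d) = cf_rem x i"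
proof -
  obtain N where N: "\<And>i. i \<ge> N \<Longrightarrow> 1 < cf_rem x i \<and> - 1 < cf_conj x x' i \<and> cf_conj x x' i < 0"
    using cf_conj_eventually_reduced[OF assms] by blast
  have "cf_rem x ` {N..} \<subseteq> {x. \<exists>x'. conj_roots s x x' \<and> 1 < x \<and> - 1 < x' \<and> x' < 0}"
    using N conj_roots_cf[OF assms] by fastforce
  then have "finite (cf_rem x ` {N..})" using finite_reduced[OF assms(2)] finite_subset by blast
  then have "\<not> inj_on (cf_rem x) {N..}" using finite_imageD infinite_Ici by blast
  then obtain i j where "i \<noteq> j" "cf_rem x i = cf_rem x j" unfolding inj_on_def by blast
  then have "\<exists>i j. i < j \<and> cf_rem x i = cf_rem x j" by (metis linorder_neqE_nat)
  then obtain i j where "i < j" "cf_rem x i = cf_rem x j" by blast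
  then show thesis using that[of "j - i" i] by simp
qed

section \<open>Symmetries of a class in terms of its roots\<close>

lemma form_class_trans:
  assumes "g \<in> form_class f" "h \<in> form_class g" shows "h \<in> form_class f"
proof -
  obtain a b c d where 1: "a * d - b * c = 1" "g = form_sub a b c d f"
    using assms(1) unfolding form_class_eq_subs by blast
  obtain a' b' c' d' where 2: "a' * d' - b' * c' = 1" "h = form_sub a' b' c' d' g"
    using assms(2) unfolding form_class_eq_subs by blast
  have "h = form_sub (a * a' + b * c') (a * b' + b * d') (c * a' + d * c') (c * b' + d * d') f"
    by (rule form_eval_inject) (simp add: 1 2 form_eval_sub algebra_simps)
  moreover have "(a * a' + b * c') * (c * b' + d * d') - (a * b' + b * d') * (c * a' + d * c')
      = (a * d - b * c) * (a' * d' - b' * c')" by (simp add: algebra_simps)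
  ultimately show ?thesis unfolding form_class_eq_subs 1(1) 2(1) by auto
qed

lemma invariant_under_form_class:
  assumes "\<And>f. \<sigma> (\<sigma> f) = f" "\<And>f g. g \<in> form_class f \<Longrightarrow> \<sigma> g \<in> form_class (\<sigma> f)"
  shows "invariant_under \<sigma> (form_class f) \<longleftrightarrow> \<sigma> f \<in> form_class f"
proof
  have "f \<in> form_class f"
    unfolding form_class_def
    by (rule CollectI, rule exI[of _ 1], rule exI[of _ 0], rule exI[of _ 0], rule exI[of _ 1]) simp
  then show "\<sigma> f \<in> form_class f" if "invariant_under \<sigma> (form_class f)"
    using that unfolding invariant_under_def by blast
next
  assume "\<sigma> f \<in> form_class f"
  then have "\<sigma> g \<in> form_class f" if "g \<in> form_class f" for g
    using assms(2)[OF that] form_class_trans by blast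
  then show "invariant_under \<sigma> (form_class f)"
    unfolding invariant_under_def using assms(1) by (metis image_eqI image_subsetI subsetI subset_antisym)
qed

lemma form_conj_class: "g \<in> form_class f \<Longrightarrow> form_conj g \<in> form_class (form_conj f)"
proof -
  assume "g \<in> form_class f"
  then obtain a b c d where 1: "a * d - b * c = 1" "g = form_sub a b c d f"
    unfolding form_class_eq_subs by blast
  have "form_conj g = form_sub a (- b) (- c) d (form_conj f)"
    by (cases f) (simp add: 1 algebra_simps)
  then show ?thesis unfolding form_class_eq_subs using 1(1) by force
qed

lemma form_adjoint_class: "g \<in> form_class f \<Longrightarrow> form_adjoint g \<in> form_class (form_adjoint f)"
proof -
  assume "g \<in> form_class f"
  then obtain a b c d where 1: "a * d - b * c = 1" "g = form_sub a b c d f"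
    unfolding form_class_eq_subs by blast
  have "form_adjoint g = form_sub d (- c) (- b) a (form_adjoint f)"
    by (cases f) (simp add: 1 algebra_simps)
  moreover have "d * a - (- c) * (- b) = 1" using 1(1) by (simp add: algebra_simps)
  ultimately show ?thesis unfolding form_class_eq_subs by blast
qed

lemma form_antipodal_eq: "form_antipodal f = form_conj (form_adjoint f)"
  by (cases f) simp

text \<open>The involutions send the root \<open>x\<close> to \<open>- x'\<close> (conjugate), \<open>- 1 / x'\<close> (adjoint) and \<open>1 / x\<close>
  (antipodal). Hence they preserve the class iff \<open>x\<close> is connected with \<open>x'\<close> by determinant
  \<open>- 1\<close>, with \<open>x'\<close> by determinant \<open>1\<close>, and with itself by determinant \<open>- 1\<close>, respectively. Any two of
  these imply the third, which leaves only two conditions.\<close>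

lemma k_symmetric_iff_mobius_rel:
  assumes "form_root s f x" "form_root (- s) f x'" "s \<notin> \<rat>"
  shows "k_symmetric (form_class f) \<longleftrightarrow> mobius_rel False x' x \<and> \<not> mobius_rel False x x"
proof -
  obtain m n k where f: "f = (m, n, k)" by (metis prod_cases3)
  have s': "- s \<notin> \<rat>" using assms(3) by simp
  have irr: "x \<notin> \<rat>" "x' \<notin> \<rat>" using form_root_irrational assms s' by blast+
  then have nz: "x \<noteq> 0" "x' \<noteq> 0" by auto
  have q: "of_int m * x\<^sup>2 + of_int k * x + of_int n = 0" "of_int m * x'\<^sup>2 + of_int k * x' + of_int n = 0"
    using form_root_zero assms s' f by blast+
  have n: "of_int n / x = - (of_int m * x + of_int k)" "of_int n / x' = - (of_int m * x' + of_int k)"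
    using q nz by (simp_all add: field_simps power2_eq_square)
  have r: "s\<^sup>2 = of_int (k\<^sup>2 - 4 * m * n)" "2 * of_int m * x + of_int k = s" "2 * of_int m * x' + of_int k = - s"
    using assms f by auto
  have c: "form_root s (form_conj f) (- x')" using r f by simp
  have "2 * of_int (- n) * (- 1 / x') = 2 * (of_int n / x')" by simp
  then have "2 * of_int (- n) * (- 1 / x') + of_int k = s" using n(2) r(3) by simp
  then have a: "form_root s (form_adjoint f) (- 1 / x')" using r(1) f by (simp add: algebra_simps)
  have "2 * of_int (- n) * (1 / x) = - 2 * (of_int n / x)" by simp
  then have "2 * of_int (- n) * (1 / x) + of_int (- k) = s" using n(1) r(2) by simp
  then have p: "form_root s (form_antipodal f) (1 / x)" using r(1) f by (simp add: algebra_simps)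
  have "invariant_under form_conj (form_class f) \<longleftrightarrow> mobius_rel True (- x') x"
    unfolding form_class_iff_mobius_rel[OF assms(1) c assms(3), symmetric]
    by (rule invariant_under_form_class[OF _ form_conj_class]) auto
  moreover have "mobius_rel True (- x') x \<longleftrightarrow> mobius_rel False x' x"
    using mobius_rel_trans[OF mobius_rel_minus[of x'], of False x]
      mobius_rel_trans[OF mobius_rel_sym[OF mobius_rel_minus[of x']], of True x] by auto
  moreover have "invariant_under form_adjoint (form_class f) \<longleftrightarrow> mobius_rel True (- 1 / x') x"
    unfolding form_class_iff_mobius_rel[OF assms(1) a assms(3), symmetric]
    by (rule invariant_under_form_class[OF _ form_adjoint_class]) auto
  moreover have "mobius_rel True (- 1 / x') x \<longleftrightarrow> mobius_rel True x' x"
    using mobius_rel_trans[OF mobius_rel_neg_inverse[OF nz(2)], of True x]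
      mobius_rel_trans[OF mobius_rel_sym[OF mobius_rel_neg_inverse[OF nz(2)]], of True x] by auto
  moreover have "invariant_under form_antipodal (form_class f) \<longleftrightarrow> mobius_rel True (1 / x) x"
    unfolding form_class_iff_mobius_rel[OF assms(1) p assms(3), symmetric]
    by (rule invariant_under_form_class)
       (auto simp: form_antipodal_eq intro: form_conj_class form_adjoint_class)
  moreover have "mobius_rel True (1 / x) x \<longleftrightarrow> mobius_rel False x x"
    using mobius_rel_trans[OF mobius_rel_inverse[OF nz(1)], of False x]
      mobius_rel_trans[OF mobius_rel_sym[OF mobius_rel_inverse[OF nz(1)]], of True x] by auto
  moreover have "mobius_rel False x x" if "mobius_rel False x' x" "mobius_rel True x' x"
    using mobius_rel_trans[OF mobius_rel_sym[OF that(1)] that(2)] by simp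
  ultimately show ?thesis unfolding k_symmetric_def by blast
qed

section \<open>Minimal blocks and palindromes\<close>

lemma repeating_block_of_period:
  assumes "d > 0" "\<And>i. i \<ge> N \<Longrightarrow> a (i + d) = a i"
  shows "\<exists>p. repeating_block a p \<and> length p = d"
proof -
  have per: "a (N + r + d * j) = a (N + r)" for r j
  proof (induction j)
    case (Suc j)
    then show ?case using assms(2)[of "N + r + d * j"] by (simp add: algebra_simps)
  qed simp
  let ?p = "map (\<lambda>i. a (N + i)) [0..<d]"
  have "a (N + i) = ?p ! (i mod length ?p)" for i
    using per[of "i mod d" "i div d"] assms(1) by (simp add: add.assoc)
  then have "repeating_block a ?p" unfolding repeating_block_def using assms(1) by auto
  then show ?thesis by (intro exI[of _ ?p]) simp
qed

lemma min_blocks_nonempty: "repeating_block a q \<Longrightarrow> \<exists>p. p \<in> min_blocks a"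
  using ex_has_least_nat[of "repeating_block a" q length] unfolding min_blocks_def by blast

text \<open>Otherwise the remainder of \<open>d\<close> modulo the minimal length would be a shorter eventual period.\<close>

lemma min_block_length_dvd:
  assumes p: "p \<in> min_blocks a" and d: "\<And>i. i \<ge> N \<Longrightarrow> a (i + d) = a i"
  shows "length p dvd d"
proof (rule ccontr)
  let ?L = "length p"
  assume "\<not> ?L dvd d"
  then have r: "d mod ?L > 0" by (simp add: dvd_eq_mod_eq_0)
  obtain M where ne: "p \<noteq> []" and M: "\<And>i. a (M + i) = p ! (i mod ?L)"
    using p unfolding min_blocks_def repeating_block_def by blast
  have "a (i + d mod ?L) = a i" if "i \<ge> max M N" for i
  proof -
    have "a (i + d mod ?L) = p ! ((i + d mod ?L - M) mod ?L)"
      using M[of "i + d mod ?L - M"] that by simp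
    also have "i + d mod ?L - M = (i - M) + d mod ?L" using that by simp
    also have "((i - M) + d mod ?L) mod ?L = ((i - M) + d) mod ?L" by (simp add: mod_add_right_eq)
    also have "p ! \<dots> = a (i + d)" using M[of "(i - M) + d"] that by simp
    also have "\<dots> = a i" using d that by simp
    finally show ?thesis .
  qed
  from repeating_block_of_period[where a = a, OF r this] obtain q
    where "repeating_block a q" "length q = d mod ?L" by blast
  moreover have "d mod ?L < ?L" using ne by simp
  ultimately show False using p unfolding min_blocks_def by (metis (no_types, lifting) mem_Collect_eq not_le)
qed

lemma rev_eq_rotate_if_palindromes:
  "palindrome u \<Longrightarrow> palindrome v \<Longrightarrow> rev (u @ v) = rotate (length u) (u @ v)"
  by (simp add: palindrome_def rotate_append)

text \<open>Cut \<open>p = u v\<close> after \<open>r mod length p\<close> entries. Then \<open>rev p = rev v rev u\<close> equals \<open>v u\<close>, and both parts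
  match because the lengths agree. The length of \<open>p\<close> is even, so reduction modulo it preserves
  the parity of \<open>r\<close>.\<close>

lemma palindromes_if_rev_eq_rotate:
  assumes "rev p = rotate r p" "odd r" "even (length p)" "p \<noteq> []"
  shows "\<exists>u v. p = u @ v \<and> odd (length u) \<and> odd (length v) \<and> palindrome u \<and> palindrome v"
proof -
  define t where "t = r mod length p"
  have t: "t < length p" "odd t" unfolding t_def using assms by (auto simp: dvd_mod_iff)
  have "rev p = rotate t p" unfolding t_def using assms(1) rotate_conv_mod by metis
  also have "\<dots> = drop t p @ take t p" using t by (simp add: rotate_drop_take)
  finally have "rev (take t p @ drop t p) = drop t p @ take t p" by simp
  then have "rev (drop t p) @ rev (take t p) = drop t p @ take t p" unfolding rev_append .
  then have "rev (drop t p) = drop t p" "rev (take t p) = take t p" by auto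
  then show ?thesis using t assms(3)
    by (intro exI[of _ "take t p"] exI[of _ "drop t p"]) (auto simp: palindrome_def)
qed

section \<open>The dual continued fraction\<close>

text \<open>A sequence with this recursion traverses a continued fraction backwards: the digits of
  \<open>\<phi> M\<close> are \<open>b (M - 1), b (M - 2), \<dots>\<close>.\<close>

lemma cf_rem_backward_chain:
  assumes "\<And>i. \<phi> i > 1" "\<And>i. \<phi> (Suc i) = of_int (b i) + 1 / \<phi> i"
  shows "j \<le> M \<Longrightarrow> cf_rem (\<phi> M) j = \<phi> (M - j)"
    and "j < M \<Longrightarrow> cf_coeff (\<phi> M) j = b (M - Suc j)"
proof -
  have fl: "\<lfloor>\<phi> (Suc i)\<rfloor> = b i" for i
    using assms(1)[of i] unfolding assms(2)[of i] by (intro floor_unique) auto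
  have fr: "1 / frac (\<phi> (Suc i)) = \<phi> i" for i
    using assms(2)[of i] unfolding frac_def fl by simp
  show rem: "cf_rem (\<phi> M) j = \<phi> (M - j)" if "j \<le> M" for j
    using that
  proof (induction j)
    case (Suc j)
    then have "M - j = Suc (M - Suc j)" by simp
    then show ?case using Suc fr[of "M - Suc j"] by simp
  qed simp
  assume "j < M"
  then have "M - j = Suc (M - Suc j)" by simp
  then show "cf_coeff (\<phi> M) j = b (M - Suc j)"
    using rem[of j] fl[of "M - Suc j"] \<open>j < M\<close> unfolding cf_coeff_def by simp
qed

text \<open>Galois' theorem on reversed periods. Far enough out the complete quotient \<open>\<theta>\<close> is purely periodic with a
  conjugate \<open>\<theta>'\<close> in \<open>(-1, 0)\<close>. Conjugating \<open>\<theta>\<^sub>i = a\<^sub>i + 1 / \<theta>\<^sub>i\<^sub>+\<^sub>1\<close> shows that the numbers \<open>- 1 / \<theta>'\<^sub>i\<close>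
  form a backward chain with the digits \<open>a\<^sub>i\<close>, so \<open>\<phi> = - 1 / \<theta>'\<close> has the reversed period. Since
  \<open>\<theta>' \<mapsto> - 1 / \<theta>'\<close> has determinant \<open>1\<close>, the relations between \<open>x\<close> and \<open>x'\<close> become
  relations between the tails \<open>\<theta>\<close> and \<open>\<phi>\<close>.\<close>

lemma periodic_tail_with_dual:
  assumes roots: "conj_roots s x x'" "s \<notin> \<rat>" and block: "repeating_block (cf_coeff x) p"
  obtains N \<phi> where "\<phi> \<notin> \<rat>"
    "\<And>i. cf_coeff (cf_rem x N) i = p ! (i mod length p)"
    "\<And>i. cf_coeff \<phi> i = rev p ! (i mod length p)"
    "\<And>b. mobius_rel b x' x \<longleftrightarrow> tail_rel b \<phi> (cf_rem x N)"
    "\<And>b. mobius_rel b x x \<longleftrightarrow> tail_rel b (cf_rem x N) (cf_rem x N)"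
proof -
  let ?L = "length p"
  have irr: "cf_rem x i \<notin> \<rat>" "cf_conj x x' i \<notin> \<rat>" for i
    using conj_roots_irrational[OF conj_roots_cf[OF roots] roots(2)] by blast+
  have xirr: "x \<notin> \<rat>" using irr(1)[of 0] by simp
  obtain N0 where N0: "\<And>i. i \<ge> N0 \<Longrightarrow> 1 < cf_rem x i \<and> - 1 < cf_conj x x' i \<and> cf_conj x x' i < 0"
    using cf_conj_eventually_reduced[OF roots] by blast
  obtain N1 where p: "p \<noteq> []" and N1: "\<And>i. cf_coeff x (N1 + i) = p ! (i mod ?L)"
    using block unfolding repeating_block_def by blast
  \<comment> \<open>Adding whole periods to \<open>N1\<close> makes the tail reduced without rotating the block.\<close>
  define N where "N = N1 + ?L * N0"
  have "N0 \<le> ?L * N0" using p by (cases p) auto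
  then have NN: "N \<ge> N0" unfolding N_def by linarith
  have N: "cf_coeff x (N + i) = p ! (i mod ?L)" for i
    using N1[of "?L * N0 + i"] unfolding N_def by (simp add: add.assoc)
  have per: "cf_rem x (N + ?L * j) = cf_rem x N" for j
    by (rule cf_coeff_inject[OF irr(1) irr(1)]) (simp add: cf_coeff_cf_rem N add.assoc)
  have per': "cf_conj x x' (N + ?L * j) = cf_conj x x' N" for j
    using conj_roots_unique[OF _ conj_roots_cf[OF roots] roots(2)]
      conj_roots_cf[OF roots, of "N + ?L * j"] unfolding per by blast
  define \<phi> where "\<phi> i = - 1 / cf_conj x x' (N + i)" for i
  have red: "- 1 < cf_conj x x' (N + i)" "cf_conj x x' (N + i) < 0" for i using N0[of "N + i"] NN by auto
  have gt: "\<phi> i > 1" for i unfolding \<phi>_def using red[of i] by (simp add: field_simps)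
  have step: "\<phi> (Suc i) = of_int (cf_coeff x (N + i)) + 1 / \<phi> i" for i
    unfolding \<phi>_def using red[of i] by (simp add: field_simps)
  have cf\<phi>: "cf_coeff (\<phi> 0) i = rev p ! (i mod ?L)" for i
  proof -
    \<comment> \<open>Periodicity lets the backward chain start at an index \<open>?M\<close> beyond \<open>i\<close>.\<close>
    let ?M = "?L * Suc (i div ?L)"
    have i: "i mod ?L < ?L" using p by simp
    have M: "?M - Suc i = ?L - Suc (i mod ?L)" "i < ?M"
      using mult_div_mod_eq[of ?L i] i unfolding mult_Suc_right by linarith+
    have "\<phi> 0 = \<phi> ?M" unfolding \<phi>_def using per'[of "Suc (i div ?L)"] by simp
    then have "cf_coeff (\<phi> 0) i = cf_coeff x (N + (?M - Suc i))"
      using cf_rem_backward_chain(2)[of \<phi> "\<lambda>i. cf_coeff x (N + i)", OF gt step M(2)] by simp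
    also have "\<dots> = p ! (?L - Suc (i mod ?L))" unfolding N M(1) using p by simp
    also have "\<dots> = rev p ! (i mod ?L)" using i by (simp add: rev_nth)
    finally show ?thesis .
  qed
  have \<phi>irr: "\<phi> 0 \<notin> \<rat>"
    using irr(2)[of N] Rats_inverse_iff[of "cf_conj x x' N"] unfolding \<phi>_def by simp
  have "cf_conj x x' N \<noteq> 0" using irr(2)[of N] by auto
  then have \<phi>rel: "mobius_rel True (\<phi> 0) (cf_conj x x' N)"
    using mobius_rel_neg_inverse unfolding \<phi>_def by simp
  have "mobius_rel b x' x \<longleftrightarrow> tail_rel b (\<phi> 0) (cf_rem x N)" for b
  proof -
    have "mobius_rel b x' x \<longleftrightarrow> mobius_rel b (cf_conj x x' N) (cf_rem x N)"
      by (rule mobius_rel_cong[OF mobius_rel_cf_rem[OF xirr] mobius_rel_cf_conj[OF roots]])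
    also have "\<dots> \<longleftrightarrow> mobius_rel b (\<phi> 0) (cf_rem x N)"
      by (rule mobius_rel_cong[OF mobius_rel_refl mobius_rel_sym[OF \<phi>rel]])
    finally show ?thesis using tail_rel_iff_mobius_rel[OF \<phi>irr irr(1)] by simp
  qed
  moreover have "mobius_rel b x x \<longleftrightarrow> tail_rel b (cf_rem x N) (cf_rem x N)" for b
    using mobius_rel_cong[OF mobius_rel_cf_rem[OF xirr] mobius_rel_cf_rem[OF xirr]]
      tail_rel_iff_mobius_rel[OF irr(1) irr(1)] by simp
  moreover have "cf_coeff (cf_rem x N) i = p ! (i mod ?L)" for i
    unfolding cf_coeff_cf_rem by (rule N)
  ultimately show thesis using that[OF \<phi>irr _ cf\<phi>] by blast
qed

section \<open>Bipalindromic periods\<close>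

text \<open>A purely periodic tail recurs exactly at multiples of the minimal length, so it recurs at an odd
  distance iff that length is odd.\<close>

lemma odd_length_iff_tail_rel:
  assumes "x \<notin> \<rat>" and p: "p \<in> min_blocks (cf_coeff x)"
    and cf: "\<And>i. cf_coeff (cf_rem x N) i = p ! (i mod length p)"
  shows "odd (length p) \<longleftrightarrow> tail_rel False (cf_rem x N) (cf_rem x N)"
proof
  let ?\<theta> = "cf_rem x N"
  have irr: "?\<theta> \<notin> \<rat>" using assms(1) by (rule irrational_cf_rem)
  assume "odd (length p)"
  moreover have "cf_rem ?\<theta> (length p) = cf_rem ?\<theta> 0"
    by (rule cf_coeff_inject) (use irr irrational_cf_rem in \<open>simp_all add: cf_coeff_cf_rem[of ?\<theta>] cf\<close>)
  ultimately show "tail_rel False ?\<theta> ?\<theta>" by (intro tail_relI[of _ "length p" _ 0]) auto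
next
  assume "tail_rel False (cf_rem x N) (cf_rem x N)"
  then obtain i j where ij: "cf_rem x (N + i) = cf_rem x (N + j)" "odd (i + j)"
    unfolding tail_rel_def by (auto simp: cf_rem_add)
  have "odd (length p)" if "i < j" "cf_rem x (N + i) = cf_rem x (N + j)" "odd (i + j)" for i j
  proof -
    have "cf_coeff x (t + (j - i)) = cf_coeff x t" if "t \<ge> N + i" for t
    proof -
      have "t + (j - i) = N + j + (t - (N + i))" "t = N + i + (t - (N + i))"
        using that \<open>i < j\<close> by auto
      then show ?thesis using \<open>cf_rem x (N + i) = cf_rem x (N + j)\<close> by (metis cf_coeff_cf_rem)
    qed
    from min_block_length_dvd[OF p this] have "length p dvd j - i" .
    moreover have "odd (j - i)" using that by auto
    ultimately show ?thesis using dvd_trans by blast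
  qed
  moreover have "i \<noteq> j" using ij(2) by auto
  ultimately show "odd (length p)" using ij by (metis add.commute linorder_neqE_nat)
qed

text \<open>The right-hand side says that the reversed period is a shift of the period by an odd
  number of digits and that the period length is even. Such a shift splits the
  period into two odd palindromes, and two odd palindromes give such a shift.\<close>

theorem bipalindromic_iff_mobius_rel:
  assumes roots: "conj_roots s x x'" "s \<notin> \<rat>"
  shows "bipalindromic (min_blocks (cf_coeff x)) \<longleftrightarrow> mobius_rel False x' x \<and> \<not> mobius_rel False x x"
proof
  have irr: "x \<notin> \<rat>" using conj_roots_irrational roots by blast
  assume "bipalindromic (min_blocks (cf_coeff x))"
  then obtain u v where uv: "u @ v \<in> min_blocks (cf_coeff x)" "odd (length u)" "odd (length v)"
    "palindrome u" "palindrome v" unfolding bipalindromic_def by blast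
  define p where "p = u @ v"
  have p: "p \<in> min_blocks (cf_coeff x)" "even (length p)" unfolding p_def using uv by auto
  then have block: "repeating_block (cf_coeff x) p" unfolding min_blocks_def by blast
  obtain N \<phi> where \<phi>: "\<phi> \<notin> \<rat>"
    "\<And>i. cf_coeff (cf_rem x N) i = p ! (i mod length p)"
    "\<And>i. cf_coeff \<phi> i = rev p ! (i mod length p)"
    "\<And>b. mobius_rel b x' x \<longleftrightarrow> tail_rel b \<phi> (cf_rem x N)"
    "\<And>b. mobius_rel b x x \<longleftrightarrow> tail_rel b (cf_rem x N) (cf_rem x N)"
    by (rule periodic_tail_with_dual[OF roots block]) (rule that; assumption)
  have ne: "p \<noteq> []" using uv(2) unfolding p_def by auto
  have "cf_rem \<phi> 0 = cf_rem (cf_rem x N) (length u)"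
  proof (rule cf_coeff_inject)
    fix i
    have "rev p ! (i mod length p) = rotate (length u) p ! (i mod length p)"
      using rev_eq_rotate_if_palindromes[OF uv(4,5)] unfolding p_def by simp
    also have "\<dots> = p ! ((length u + i) mod length p)"
      using ne by (simp add: nth_rotate mod_add_right_eq)
    finally show "cf_coeff (cf_rem \<phi> 0) i = cf_coeff (cf_rem (cf_rem x N) (length u)) i"
      by (simp add: cf_coeff_cf_rem[of "cf_rem x N"] \<phi>(2,3))
  qed (use \<phi>(1) irr irrational_cf_rem in auto)
  then have "tail_rel False \<phi> (cf_rem x N)" using uv(2) by (intro tail_relI[of _ 0 _ "length u"]) auto
  then show "mobius_rel False x' x \<and> \<not> mobius_rel False x x"
    using odd_length_iff_tail_rel[OF irr p(1) \<phi>(2)] p(2) \<phi>(4,5) by simp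
next
  have irr: "x \<notin> \<rat>" using conj_roots_irrational roots by blast
  assume rel: "mobius_rel False x' x \<and> \<not> mobius_rel False x x"
  obtain i0 d where d: "d > 0" "cf_rem x (i0 + d) = cf_rem x i0"
    using cf_rem_eventually_periodic[OF roots] by blast
  have "cf_coeff x (i + d) = cf_coeff x i" if "i \<ge> i0" for i
  proof -
    have "i + d = i0 + d + (i - i0)" "i = i0 + (i - i0)" using that by auto
    then show ?thesis using d(2) by (metis cf_coeff_cf_rem)
  qed
  from repeating_block_of_period[where a = "cf_coeff x", OF d(1) this] obtain p where p: "p \<in> min_blocks (cf_coeff x)"
    using min_blocks_nonempty by blast
  then have block: "repeating_block (cf_coeff x) p" unfolding min_blocks_def by blast
  then have ne: "p \<noteq> []" unfolding repeating_block_def by blast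
  let ?L = "length p"
  obtain N \<phi> where \<phi>: "\<phi> \<notin> \<rat>"
    "\<And>i. cf_coeff (cf_rem x N) i = p ! (i mod length p)"
    "\<And>i. cf_coeff \<phi> i = rev p ! (i mod length p)"
    "\<And>b. mobius_rel b x' x \<longleftrightarrow> tail_rel b \<phi> (cf_rem x N)"
    "\<And>b. mobius_rel b x x \<longleftrightarrow> tail_rel b (cf_rem x N) (cf_rem x N)"
    by (rule periodic_tail_with_dual[OF roots block]) (rule that; assumption)
  have even: "even ?L" using odd_length_iff_tail_rel[OF irr p \<phi>(2)] rel \<phi>(5) by simp
  obtain i j where ij: "cf_rem \<phi> i = cf_rem (cf_rem x N) j" "odd (i + j)"
    using rel \<phi>(4) unfolding tail_rel_def by auto
  have coeffs: "rev p ! ((i + t) mod ?L) = p ! ((j + t) mod ?L)" for t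
    using arg_cong[OF ij(1), of "\<lambda>z. cf_coeff z t"] unfolding cf_coeff_cf_rem[of \<phi>] cf_coeff_cf_rem[of "cf_rem x N"] \<phi>(2,3) .
  \<comment> \<open>This is \<open>j - i\<close> modulo \<open>?L\<close>, written as a natural number; as \<open>?L\<close> is even, it has the parity of \<open>i + j\<close>.\<close>
  define r where "r = j + (?L * i - i)"
  have iL: "i \<le> ?L * i" using ne by (cases p) auto
  have "even (?L * i - i + i)" using iL even by simp
  then have "odd r" unfolding r_def using ij(2) by simp
  moreover have "rev p = rotate r p"
  proof (rule nth_equalityI)
    fix t assume t: "t < length (rev p)"
    have "rev p ! t = rev p ! ((?L * i + t) mod ?L)" using t by simp
    also have "?L * i + t = i + (?L * i - i + t)" using iL by linarith
    also have "rev p ! ((i + (?L * i - i + t)) mod ?L) = p ! ((r + t) mod ?L)"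
      unfolding coeffs r_def by (simp add: add.assoc)
    also have "\<dots> = rotate r p ! t" using t by (simp add: nth_rotate)
    finally show "rev p ! t = rotate r p ! t" .
  qed simp
  ultimately show "bipalindromic (min_blocks (cf_coeff x))"
    using palindromes_if_rev_eq_rotate[OF _ _ even ne] p unfolding bipalindromic_def by metis
qed

theorem theorem3p7:
  fixes m n k :: int
  assumes "k\<^sup>2 - 4 * m * n > 0"
    and "\<not> is_square (k\<^sup>2 - 4 * m * n)"
  shows "bipalindromic (Period (m, n, k)) \<longleftrightarrow> k_symmetric (form_class (m, n, k))"
proof -
  define s where "s = sqrt (real_of_int (k\<^sup>2 - 4 * m * n))"
  have s: "s \<notin> \<rat>" unfolding s_def by (rule sqrt_nonsquare_irrational[OF assms])
  have s2: "s\<^sup>2 = of_int (k\<^sup>2 - 4 * m * n)"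
    unfolding s_def using assms(1) by (intro real_sqrt_pow2) (simp only: of_int_0_le_iff)
  have m: "m \<noteq> 0" using assms(2) by (auto intro: is_nth_powerI)
  define x x' where "x = xi_plus (m, n, k)" and "x' = (- of_int k - s) / (2 * of_int m)"
  have roots: "form_root s (m, n, k) x" "form_root (- s) (m, n, k) x'"
    using s2 m unfolding x_def x'_def by (simp_all add: s_def)
  then have cr: "conj_roots s x x'" unfolding conj_roots_def by blast
  \<comment> \<open>The period is read off from \<open>\<bar>x\<bar>\<close>; negating \<open>x\<close> and \<open>x'\<close> together keeps all determinants.\<close>
  define y' where "y' = (if x < 0 then - x' else x')"
  have "conj_roots s \<bar>x\<bar> y'"
    using cr conj_roots_minus[OF cr s] unfolding y'_def by auto
  from bipalindromic_iff_mobius_rel[OF this s]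
  have "bipalindromic (Period (m, n, k)) \<longleftrightarrow>
      mobius_rel False y' \<bar>x\<bar> \<and> \<not> mobius_rel False \<bar>x\<bar> \<bar>x\<bar>"
    unfolding Period_def x_def .
  moreover have "mobius_rel b y' \<bar>x\<bar> \<longleftrightarrow> mobius_rel b x' x" "mobius_rel b \<bar>x\<bar> \<bar>x\<bar> \<longleftrightarrow> mobius_rel b x x" for b
    using mobius_rel_cong[OF mobius_rel_minus[of x] mobius_rel_minus[of x']]
      mobius_rel_cong[OF mobius_rel_minus[of x] mobius_rel_minus[of x]]
    unfolding y'_def by (cases "x < 0"; simp add: abs_if)+
  ultimately show ?thesis using k_symmetric_iff_mobius_rel[OF roots s] by simp
qed

end
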